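(* Let $A\in\mathbb{R}^{n\times n}$, $B\in\mathbb{R}^{n\times m}$, $C\in\mathbb{R}^{m\times n}$, and let $K^P=\operatorname{diag}(K^P_1,\dots,K^P_m)$ and $K^I=\operatorname{diag}(K^I_1,\dots,K^I_m)$ be real diagonal matrices. Consider the linear system $$\dot{x}(t)=Ax(t)+Bu(t)+d(t),\qquad y(t)=Cx(t)+\eta(t),$$ with $u$ given by the decentralized PI-controller $$u_i(t)=K^P_i\,(r_i(t)-y_i(t))+K^I_i\int_0^t (r_i(\tau)-y_i(\tau))\,\mathrm{d}\tau,\qquad i=1,\dots,m.$$ The resulting closed-loop system satisfies $\|e_0\|=0$ for any constant disturbance $d(t)=d$ for all $t$ ($d\in\mathbb{R}^n$) and any constant measurement noise $\eta(t)=\eta$ for all $t$ ($\eta\in\mathbb{R}^m$) only if the matrix $$\Xi=\begin{bmatrix} A & BK^I\\ C & 0_{m\times m}\end{bmatrix}$$ has full rank.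
   Context: Here $x(t)\in\mathbb{R}^n$ is the state, $u(t)\in\mathbb{R}^m$ the control input, $y(t)\in\mathbb{R}^m$ the output, $d(t)\in\mathbb{R}^n$ a disturbance, $\eta(t)\in\mathbb{R}^m$ measurement noise, and $r(t)\in\mathbb{R}^m$ the reference value for the output. The system has as many sensors as actuators ($m$ of each); $u_i,y_i,r_i$ denote the $i$-th components. The output error is $e(t)=r(t)-y(t)$, and the steady-state output error is $e_0=\lim_{t\to\infty}e(t)$.
   Formalization: The formal statement also requires the state x(t) to converge for each constant d and η; with only e(t)→0 the claim is false: x1'=d1, x2'=-x2+u+d2, y=x2+η, K^P=K^I=1, r constant, has e_0=0 always, but the first row of Ξ is zero. *)

theory Defs
  imports "HOL-Analysis.Analysis"
begin

definition diag_mat :: "real ^ 'm \<Rightarrow> real ^ 'm ^ 'm"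
  where "diag_mat k = (\<chi> i j. if i = j then k $ i else 0)"

definition block_mat ::
    "real ^ 'n ^ 'n \<Rightarrow> real ^ 'm ^ 'n \<Rightarrow> real ^ 'n ^ 'm \<Rightarrow> real ^ 'm ^ 'm \<Rightarrow>
     real ^ ('n + 'm) ^ ('n + 'm)"
  where "block_mat P Q R S = (\<chi> i j.
    case i of
      Inl a \<Rightarrow> (case j of Inl b \<Rightarrow> P $ a $ b | Inr b \<Rightarrow> Q $ a $ b)
    | Inr a \<Rightarrow> (case j of Inl b \<Rightarrow> R $ a $ b | Inr b \<Rightarrow> S $ a $ b))"

definition Xi_mat ::
    "real ^ 'n ^ 'n \<Rightarrow> real ^ 'm ^ 'n \<Rightarrow> real ^ 'n ^ 'm \<Rightarrow> real ^ 'm \<Rightarrow>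
     real ^ ('n + 'm) ^ ('n + 'm)"
  where "Xi_mat A B C KI = block_mat A (B ** diag_mat KI) C 0"

text \<open>
  The signals \<open>x\<close>, \<open>u\<close>, \<open>y\<close> form a trajectory, on the time axis \<open>t \<ge> 0\<close>, of the plant in
  feedback with the decentralized PI controller with proportional gains \<open>KP\<close>, integral
  gains \<open>KI\<close> and reference \<open>r\<close>, subject to disturbance \<open>d\<close> and measurement noise \<open>\<eta>\<close>.
  At \<open>t = 0\<close> the derivative is the right derivative. No initial state is prescribed.
  Integrability is demanded because \<^const>\<open>integral\<close> is 0 on non-integrable functions.
\<close>

definition closed_loop_trajectory ::
    "real ^ 'n ^ 'n \<Rightarrow> real ^ 'm ^ 'n \<Rightarrow> real ^ 'n ^ 'm \<Rightarrow> real ^ 'm \<Rightarrow> real ^ 'm \<Rightarrow>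
     (real \<Rightarrow> real ^ 'm) \<Rightarrow> (real \<Rightarrow> real ^ 'n) \<Rightarrow> (real \<Rightarrow> real ^ 'm) \<Rightarrow>
     (real \<Rightarrow> real ^ 'n) \<Rightarrow> (real \<Rightarrow> real ^ 'm) \<Rightarrow> (real \<Rightarrow> real ^ 'm) \<Rightarrow> bool"
  where "closed_loop_trajectory A B C KP KI r d \<eta> x u y \<longleftrightarrow>
    (\<forall>t\<ge>0.
      (x has_vector_derivative (A *v x t + B *v u t + d t)) (at t within {0..}) \<and>
      y t = C *v x t + \<eta> t \<and>
      (\<forall>i. (\<lambda>\<tau>. r \<tau> $ i - y \<tau> $ i) integrable_on {0..t} \<and>
           u t $ i = KP $ i * (r t $ i - y t $ i)
                     + KI $ i * integral {0..t} (\<lambda>\<tau>. r \<tau> $ i - y \<tau> $ i)))"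

text \<open>
  \<open>e0\<close> is the steady-state output error of the trajectory: the state settles to a (finite)
  steady state and the output error \<open>r - y\<close> tends to \<open>e0\<close>. Convergence of the state is
  part of "steady state"; it does not follow from convergence of the error, since modes
  that are invisible in the output may diverge.
\<close>

definition steady_state_error ::
    "(real \<Rightarrow> real ^ 'm) \<Rightarrow> (real \<Rightarrow> real ^ 'n) \<Rightarrow> (real \<Rightarrow> real ^ 'm) \<Rightarrow> real ^ 'm \<Rightarrow> bool"
  where "steady_state_error r x y e0 \<longleftrightarrow>
    (\<exists>xs. (x \<longlongrightarrow> xs) at_top) \<and> ((\<lambda>t. r t - y t) \<longlongrightarrow> e0) at_top"

end

theory Submission
  imports Defs
begin

text \<open>
  A rank-deficient \<open>\<Xi>\<close> has a nonzero left null vector \<open>(w, v)\<close>, that is,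
  \<open>w\<^sup>T A + v\<^sup>T C = 0\<close> and \<open>w\<^sup>T B K\<^sup>I = 0\<close>. The second equation says that the integral
  action cannot influence \<open>w \<bullet> x\<close>, so
  \<open>d/dt (w \<bullet> x) = w \<bullet> (A x + B K\<^sup>P e + d)\<close>. Along a trajectory with \<open>x \<rightarrow> x\<^sub>s\<close> and
  \<open>e \<rightarrow> 0\<close> the right-hand side converges, and since \<open>w \<bullet> x\<close> converges too, its limit
  \<open>w \<bullet> (A x\<^sub>s + d)\<close> is zero (\<open>derivative_limit_zero\<close>, \<open>steady_state_balance\<close>). Working with \<open>w \<bullet> x\<close> in place of
  \<open>x\<close> matters here, because the integrator state itself is not known to converge.

  The first equation turns \<open>w \<bullet> A x\<^sub>s\<close> into \<open>- v \<bullet> C x\<^sub>s\<close>. As the output error vanishes,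
  \<open>r\<close> converges to \<open>C x\<^sub>s + \<eta>\<close> (\<open>reference_limit\<close>); since \<open>r\<close> is the same signal for all \<open>d\<close> and \<open>\<eta>\<close>, so is its
  limit \<open>r\<^sub>\<infinity>\<close>. Altogether \<open>w \<bullet> d = v \<bullet> (r\<^sub>\<infinity> - \<eta>)\<close> for all \<open>d\<close> and all \<open>\<eta>\<close>,
  and varying \<open>d\<close> and \<open>\<eta>\<close> independently forces \<open>w = 0\<close> and \<open>v = 0\<close>.
\<close>

lemma diag_mat_mult_vec: "diag_mat k *v z = (\<chi> i. k $ i * z $ i)"
  by (simp add: vec_eq_iff diag_mat_def matrix_vector_mult_def if_distrib[where f="\<lambda>a. a * _"]
      cong: if_cong)

lemma sum_UNIV_sum_type:
  fixes f :: "'a::finite + 'b::finite \<Rightarrow> 'c::comm_monoid_add"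
  shows "sum f UNIV = (\<Sum>a\<in>UNIV. f (Inl a)) + (\<Sum>b\<in>UNIV. f (Inr b))"
  using sum.Plus[of UNIV UNIV f] by (simp add: o_def)

lemma transpose_block_mat_mult_vec:
  fixes z :: "real ^ ('n::finite + 'm::finite)"
  defines "w \<equiv> \<chi> a. z $ Inl a" and "v \<equiv> \<chi> b. z $ Inr b"
  shows "(transpose (block_mat P Q R S) *v z) $ Inl a = (transpose P *v w + transpose R *v v) $ a"
    and "(transpose (block_mat P Q R S) *v z) $ Inr b = (transpose Q *v w + transpose S *v v) $ b"
  by (simp_all add: block_mat_def transpose_def matrix_vector_mult_def sum_UNIV_sum_type w_def v_def)

text \<open>
  A square matrix has full rank as soon as its transpose is injective. The premise spells out
  this injectivity with the vectors split along the two row blocks, so that the types of the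
  state and of the output can be handled separately.
\<close>

lemma rank_block_matI:
  fixes P :: "real ^ 'n ^ 'n" and S :: "real ^ 'm ^ 'm"
  assumes "\<And>w v. transpose P *v w + transpose R *v v = 0 \<Longrightarrow>
    transpose Q *v w + transpose S *v v = 0 \<Longrightarrow> w = 0 \<and> v = 0"
  shows "rank (block_mat P Q R S) = CARD('n) + CARD('m)"
proof -
  let ?M = "transpose (block_mat P Q R S)"
  have "z = 0" if z: "?M *v z = 0" for z
  proof -
    let ?w = "\<chi> a. z $ Inl a" and ?v = "\<chi> b. z $ Inr b"
    have "?w = 0 \<and> ?v = 0"
    proof (rule assms)
      show "transpose P *v ?w + transpose R *v ?v = 0"
        using transpose_block_mat_mult_vec(1)[of P Q R S z] z by (simp add: vec_eq_iff)
      show "transpose Q *v ?w + transpose S *v ?v = 0"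
        using transpose_block_mat_mult_vec(2)[of P Q R S z] z by (simp add: vec_eq_iff)
    qed
    then have "z $ i = 0" for i
      by (cases i) (simp_all add: vec_eq_iff)
    then show ?thesis
      by (simp add: vec_eq_iff)
  qed
  then have "inj ((*v) ?M)"
    by (simp add: inj_matrix_vector_mult linear_injective_0)
  then have "rank ?M = CARD('n + 'm)"
    by (simp only: full_rank_injective)
  then show ?thesis
    by (simp add: rank_transpose)
qed

text \<open>
  The mean value theorem on \<open>[t, t + 1]\<close> realizes the increment \<open>f (t + 1) - f t\<close>, which tends
  to \<open>l - l = 0\<close>, as a value of \<open>f'\<close> at some point \<open>\<ge> t\<close>; these values tend to \<open>L\<close>.
\<close>

lemma derivative_limit_zero:
  fixes f f' :: "real \<Rightarrow> real"
  assumes deriv: "\<And>t. t > a \<Longrightarrow> (f has_real_derivative f' t) (at t)"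
    and f: "(f \<longlongrightarrow> l) at_top" and f': "(f' \<longlongrightarrow> L) at_top"
  shows "L = 0"
proof -
  have "\<exists>c. t > a \<longrightarrow> t < c \<and> f (t + 1) - f t = f' c" for t
    using MVT2[of t "t + 1" f f'] deriv by force
  then obtain c where c: "\<And>t. t > a \<Longrightarrow> t < c t \<and> f (t + 1) - f t = f' (c t)"
    by metis
  have "filterlim c at_top at_top"
    by (rule filterlim_at_top_mono[OF filterlim_ident])
      (use c in \<open>auto intro: less_imp_le eventually_mono[OF eventually_gt_at_top[of a]]\<close>)
  with f' have lim_L: "((\<lambda>t. f' (c t)) \<longlongrightarrow> L) at_top"
    by (rule filterlim_compose)
  have "filterlim (\<lambda>t::real. t + 1) at_top at_top"
    by (rule filterlim_at_top_mono[OF filterlim_ident]) simp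
  with f have "((\<lambda>t. f (t + 1)) \<longlongrightarrow> l) at_top"
    by (rule filterlim_compose)
  then have "((\<lambda>t. f (t + 1) - f t) \<longlongrightarrow> l - l) at_top"
    using f by (rule tendsto_diff)
  moreover have "\<forall>\<^sub>F t in at_top. f (t + 1) - f t = f' (c t)"
    using c by (auto intro: eventually_mono[OF eventually_gt_at_top[of a]])
  ultimately have "((\<lambda>t. f' (c t)) \<longlongrightarrow> 0) at_top"
    by (simp add: tendsto_cong)
  with lim_L show ?thesis
    by (intro tendsto_unique) auto
qed

lemma closed_loop_control:
  assumes "closed_loop_trajectory A B C KP KI r d \<eta> x u y" and "t \<ge> 0"
  shows "u t = diag_mat KP *v (r t - y t)
    + diag_mat KI *v (\<chi> i. integral {0..t} (\<lambda>\<tau>. r \<tau> $ i - y \<tau> $ i))"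
  using assms by (simp add: closed_loop_trajectory_def vec_eq_iff diag_mat_mult_vec)

text \<open>
  The hypothesis on \<open>w\<close> makes the direction \<open>w\<close> of the state immune to the integral action, whose
  integrator may fail to settle. In that direction the forces acting on the state therefore
  converge, and at the steady state they must cancel.
\<close>

lemma steady_state_balance:
  fixes A :: "real ^ 'n ^ 'n" and B :: "real ^ 'm ^ 'n" and C :: "real ^ 'n ^ 'm"
  assumes traj: "closed_loop_trajectory A B C KP KI r (\<lambda>_. d) \<eta> x u y"
    and x: "(x \<longlongrightarrow> xs) at_top" and e: "((\<lambda>t. r t - y t) \<longlongrightarrow> 0) at_top"
    and w: "transpose (B ** diag_mat KI) *v w = 0"
  shows "w \<bullet> (A *v xs + d) = 0"
proof (rule derivative_limit_zero[where a = 0])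
  let ?f' = "\<lambda>t. w \<bullet> (A *v x t + B *v (diag_mat KP *v (r t - y t)) + d)"
  show "((\<lambda>t. w \<bullet> x t) has_real_derivative ?f' t) (at t)" if "t > 0" for t
  proof -
    let ?q = "\<chi> i. integral {0..t} (\<lambda>\<tau>. r \<tau> $ i - y \<tau> $ i)"
    have "w \<bullet> (B *v (diag_mat KI *v ?q)) = (transpose (B ** diag_mat KI) *v w) \<bullet> ?q"
      by (simp only: transpose_matrix_vector dot_lmul_matrix matrix_vector_mul_assoc)
    then have no_integral_action: "w \<bullet> (B *v (diag_mat KI *v ?q)) = 0"
      by (simp only: w inner_zero_left)
    have "(x has_vector_derivative (A *v x t + B *v u t + d)) (at t within {0..})"
      using traj that by (simp add: closed_loop_trajectory_def)
    moreover have "at t within {0..} = at t"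
      using that by (intro at_within_interior) (simp add: interior_real_atLeast)
    ultimately have "(x has_vector_derivative (A *v x t + B *v u t + d)) (at t)"
      by simp
    then have "((\<lambda>t. w \<bullet> x t) has_real_derivative w \<bullet> (A *v x t + B *v u t + d)) (at t)"
      unfolding has_real_derivative_iff_has_vector_derivative
      by (rule bounded_linear.has_vector_derivative[OF bounded_linear_inner_right])
    moreover have "w \<bullet> (A *v x t + B *v u t + d) = ?f' t"
      using closed_loop_control[OF traj, of t] that no_integral_action
      by (simp add: matrix_vector_right_distrib inner_add_right)
    ultimately show ?thesis
      by simp
  qed
  show "((\<lambda>t. w \<bullet> x t) \<longlongrightarrow> w \<bullet> xs) at_top"
    by (intro tendsto_intros x)
  have "(?f' \<longlongrightarrow> w \<bullet> (A *v xs + B *v (diag_mat KP *v 0) + d)) at_top"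
    by (intro tendsto_intros x e bounded_linear.tendsto[OF matrix_vector_mul_bounded_linear])
  then show "(?f' \<longlongrightarrow> w \<bullet> (A *v xs + d)) at_top"
    by simp
qed

lemma reference_limit:
  assumes traj: "closed_loop_trajectory A B C KP KI r d (\<lambda>_. \<eta>) x u y"
    and x: "(x \<longlongrightarrow> xs) at_top" and e: "((\<lambda>t. r t - y t) \<longlongrightarrow> 0) at_top"
  shows "(r \<longlongrightarrow> C *v xs + \<eta>) at_top"
proof -
  have "((\<lambda>t. (r t - y t) + (C *v x t + \<eta>)) \<longlongrightarrow> 0 + (C *v xs + \<eta>)) at_top"
    by (intro tendsto_intros x e bounded_linear.tendsto[OF matrix_vector_mul_bounded_linear])
  moreover have "\<forall>\<^sub>F t in at_top. (r t - y t) + (C *v x t + \<eta>) = r t"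
    using traj
    by (auto simp: closed_loop_trajectory_def intro: eventually_mono[OF eventually_ge_at_top[of 0]])
  ultimately show ?thesis
    by (simp add: tendsto_cong)
qed

theorem theorem1:
  fixes A :: "real ^ 'n ^ 'n" and B :: "real ^ 'm ^ 'n" and C :: "real ^ 'n ^ 'm"
    and KP KI :: "real ^ 'm" and r :: "real \<Rightarrow> real ^ 'm"
    and x :: "real ^ 'n \<Rightarrow> real ^ 'm \<Rightarrow> real \<Rightarrow> real ^ 'n"
    and u y :: "real ^ 'n \<Rightarrow> real ^ 'm \<Rightarrow> real \<Rightarrow> real ^ 'm"
    and e0 :: "real ^ 'n \<Rightarrow> real ^ 'm \<Rightarrow> real ^ 'm"
  assumes "\<And>d \<eta>. closed_loop_trajectory A B C KP KI r (\<lambda>_. d) (\<lambda>_. \<eta>) (x d \<eta>) (u d \<eta>) (y d \<eta>)"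
    and "\<And>d \<eta>. steady_state_error r (x d \<eta>) (y d \<eta>) (e0 d \<eta>)"
    and "\<And>d \<eta>. norm (e0 d \<eta>) = 0"
  shows "rank (Xi_mat A B C KI) = CARD('n) + CARD('m)"
  unfolding Xi_mat_def
proof (rule rank_block_matI)
  fix w v
  assume state: "transpose A *v w + transpose C *v v = 0"
    and "transpose (B ** diag_mat KI) *v w + transpose (0 :: real ^ 'm ^ 'm) *v v = 0"
  then have input: "transpose (B ** diag_mat KI) *v w = 0"
    by (simp add: transpose_def matrix_vector_mult_def vec_eq_iff)
  have e: "((\<lambda>t. r t - y d \<eta> t) \<longlongrightarrow> 0) at_top" for d \<eta>
    using assms(2,3)[of d \<eta>] by (simp add: steady_state_error_def)
  have "\<exists>xs. (x d \<eta> \<longlongrightarrow> xs) at_top" for d \<eta>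
    using assms(2)[of d \<eta>] by (simp add: steady_state_error_def)
  then obtain xs where xs: "\<And>d \<eta>. (x d \<eta> \<longlongrightarrow> xs d \<eta>) at_top"
    by metis
  have r: "(r \<longlongrightarrow> C *v xs d \<eta> + \<eta>) at_top" for d \<eta>
    by (rule reference_limit[OF assms(1) xs e])
  define r_inf where "r_inf = C *v xs 0 0"
  have C_xs: "C *v xs d \<eta> = r_inf - \<eta>" for d \<eta>
    using tendsto_unique[OF _ r[of d \<eta>] r[of 0 0]] by (simp add: r_inf_def algebra_simps)
  \<comment> \<open>Left and right depend on different variables, so both sides are constant.\<close>
  have balance: "w \<bullet> d = v \<bullet> (r_inf - \<eta>)" for d \<eta>
  proof -
    have "w \<bullet> (A *v xs d \<eta>) + v \<bullet> (C *v xs d \<eta>)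
        = (transpose A *v w + transpose C *v v) \<bullet> xs d \<eta>"
      by (simp only: transpose_matrix_vector dot_lmul_matrix inner_add_left)
    also have "\<dots> = 0"
      by (simp only: state inner_zero_left)
    finally have "w \<bullet> (A *v xs d \<eta>) = - (v \<bullet> (r_inf - \<eta>))"
      by (simp add: C_xs)
    moreover have "w \<bullet> (A *v xs d \<eta> + d) = 0"
      by (rule steady_state_balance[OF assms(1) xs e input])
    ultimately show ?thesis
      by (simp add: inner_add_right)
  qed
  have "w \<bullet> w = 0"
    using balance[of w 0] balance[of 0 0] by simp
  moreover have "v \<bullet> v = 0"
    using balance[of 0 v] balance[of 0 0] by (simp add: inner_diff_right)
  ultimately show "w = 0 \<and> v = 0"
    by simp
qed

end
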